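(* Let $\theta\in[-1,1]$ and let $C:[0,1]^2\to\mathbb{R}$ be given by $$C(u,v)=(1-\theta^2)uv+\frac{\theta}{4}\Big[(1+\theta)^2\min(u,v)-(1-\theta)^2\max(u+v-1,0)\Big].$$ Then the coefficient of lower tail dependence $\lambda_L$ and the coefficient of upper tail dependence $\lambda_U$ of $C$ are both equal to $$\frac{\theta(1+\theta)^2}{4}.$$
   Context: The coefficients of lower and upper tail dependence of $C$ are $\lambda_L=\lim_{u\to0^+}\frac{C(u,u)}{u}$ and $\lambda_U=\lim_{u\to1^-}\frac{1-2u+C(u,u)}{1-u}$. *)

theory Defs
  imports Complex_Main
begin

(* The coefficients of tail dependence are limits, so they are rendered as relations between a
   function and a real number: each says that the limit exists and equals the given number.
   Only the values of C on the unit square matter. *)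

definition has_lower_tail_dependence :: "(real \<Rightarrow> real \<Rightarrow> real) \<Rightarrow> real \<Rightarrow> bool" where
  "has_lower_tail_dependence C l \<longleftrightarrow> ((\<lambda>u. C u u / u) \<longlongrightarrow> l) (at_right 0)"

definition has_upper_tail_dependence :: "(real \<Rightarrow> real \<Rightarrow> real) \<Rightarrow> real \<Rightarrow> bool" where
  "has_upper_tail_dependence C l \<longleftrightarrow>
     ((\<lambda>u. (1 - 2 * u + C u u) / (1 - u)) \<longlongrightarrow> l) (at_left 1)"

end

theory Submission
  imports Defs
begin

text \<open>On the diagonal, \<open>max (2 * u - 1) 0\<close> changes form only at
  \<open>u = 1/2\<close>, so near each endpoint C(u,u) is a quadratic polynomial in u. Each tail
  quotient is then exactly affine, \<open>(1 - \<theta>^2) * s + ?l\<close>, where s is the distance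
  from u to the endpoint, and both limits are read off at s = 0.\<close>

theorem theorem2p3:
  fixes \<theta> :: real and C :: "real \<Rightarrow> real \<Rightarrow> real"
  assumes "\<theta> \<in> {-1..1}"
    and "\<And>u v. u \<in> {0..1} \<Longrightarrow> v \<in> {0..1} \<Longrightarrow>
      C u v = (1 - \<theta>^2) * u * v
        + \<theta> / 4 * ((1 + \<theta>)^2 * min u v - (1 - \<theta>)^2 * max (u + v - 1) 0)"
  shows "has_lower_tail_dependence C (\<theta> * (1 + \<theta>)^2 / 4)
    \<and> has_upper_tail_dependence C (\<theta> * (1 + \<theta>)^2 / 4)"
proof
  let ?l = "\<theta> * (1 + \<theta>)^2 / 4"
  \<comment> \<open>Below 1/2 the max term vanishes, and the min term alone produces
    \<open>?l\<close>.\<close>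
  have "C u u / u = (1 - \<theta>^2) * u + ?l" if "0 < u" "u < 1/2" for u
    using that assms(2)[of u u] by (simp add: field_simps)
  then have "\<forall>\<^sub>F u in at_right 0. (1 - \<theta>^2) * u + ?l = C u u / u"
    by (auto simp: eventually_at_right_field intro!: exI[of _ "1/2"])
  moreover have "((\<lambda>u. (1 - \<theta>^2) * u + ?l) \<longlongrightarrow> ?l) (at_right 0)"
    by (auto intro!: tendsto_eq_intros)
  ultimately show "has_lower_tail_dependence C ?l"
    unfolding has_lower_tail_dependence_def by (rule Lim_transform_eventually[rotated])
  have "(1 - 2 * u + C u u) / (1 - u) = (1 - \<theta>^2) * (1 - u) + ?l" if "1/2 < u" "u < 1" for u
  proof -
    have "C u u = (1 - \<theta>^2) * u * u + \<theta> / 4 * ((1 + \<theta>)^2 * u - (1 - \<theta>)^2 * (2 * u - 1))"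
      using that assms(2)[of u u] by simp
    \<comment> \<open>The factor \<open>1 - u\<close> splits off because C(1,1) = 1, which rests on
      (1+\<theta>)^2 - (1-\<theta>)^2 = 4\<theta>; the same identity cancels the (1-\<theta>)^2
      contribution from the cofactor.\<close>
    then have "1 - 2 * u + C u u = ((1 - \<theta>^2) * (1 - u) + ?l) * (1 - u)"
      by (simp add: field_simps power2_eq_square)
    then show ?thesis
      using that by simp
  qed
  then have "\<forall>\<^sub>F u in at_left 1. (1 - \<theta>^2) * (1 - u) + ?l = (1 - 2 * u + C u u) / (1 - u)"
    by (auto simp: eventually_at_left_field intro!: exI[of _ "1/2"])
  moreover have "((\<lambda>u. (1 - \<theta>^2) * (1 - u) + ?l) \<longlongrightarrow> ?l) (at_left 1)"
    by (auto intro!: tendsto_eq_intros)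
  ultimately show "has_upper_tail_dependence C ?l"
    unfolding has_upper_tail_dependence_def by (rule Lim_transform_eventually[rotated])
qed

end
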